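(* Let $X,Y$ be countable subsets of $[0,\infty)$. Assume that a set $S\subset X\times Y$ contains, for some $n\ge2$, $n$ classical cycles $\mathcal C_1,\dots,\mathcal C_n$ such that: 1. $\left|\bigcup_{i=1}^n(\mathcal C_i)_X\right|=n$; 2. the cycles are free, i.e. each cycle $\mathcal C_i$ contains a path $(x,y)$ which does not belong to any other cycle $\mathcal C_k$, $k\ne i$. Then the WEP does not hold for $S$.
   Context: A path is an element $(x,y)$ of $X\times Y$. For $T\subset X\times Y$, $T_X,T_Y$ denote its projections on $X$ and $Y$. A classical cycle in $S$ is a finite closed sequence of paths of $S$ which alternately share their $y$-coordinate and their $x$-coordinate, with no other repetition of points; i.e. it consists, for some $m\ge2$, of the $2m$ paths $(a_1,b_1),(a_2,b_1),(a_2,b_2),(a_3,b_2),\dots,(a_m,b_m),(a_1,b_m)$, all in $S$, where $a_1,\dots,a_m\in X$ are distinct and $b_1,\dots,b_m\in Y$ are distinct. Its $X$-section is $\mathcal C_X=\{a_1,\dots,a_m\}$. The WEP holds for $S$ if for every $f:S\to\mathbb R$ there exist $\varphi,h:S_X\to\mathbb R$ and $\psi:S_Y\to\mathbb R$ with $f(x,y)=\varphi(x)+h(x)(y-x)-\psi(y)$ for all $(x,y)\in S$. *)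

theory Defs
  imports Complex_Main "HOL-Library.Countable_Set"
begin

text \<open>A path is a pair \<open>(x, y)\<close>; the projections of \<open>T\<close> are \<open>fst ` T\<close> and \<open>snd ` T\<close>.\<close>

text \<open>A classical cycle is identified with the set of its \<open>2 * m\<close> paths
  \<open>(a 1, b 1), (a 2, b 1), (a 2, b 2), \<dots>, (a m, b m), (a 1, b m)\<close>.
  As the cycle determines this set, and both its \<open>X\<close>-section and membership of a path only
  depend on it, the starting point and the direction of traversal are immaterial.\<close>

definition classical_cycle :: "('a \<times> 'b) set \<Rightarrow> ('a \<times> 'b) set \<Rightarrow> bool" where
  "classical_cycle S C \<longleftrightarrow>
     (\<exists>(m::nat) a b. m \<ge> 2 \<and> inj_on a {1..m} \<and> inj_on b {1..m} \<and>
        C = {(a i, b i) | i. i \<in> {1..m}} \<union> {(a (Suc i), b i) | i. i \<in> {1..<m}} \<union> {(a 1, b m)} \<and>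
        C \<subseteq> S)"

text \<open>Functions on \<open>S\<close>, on \<open>fst ` S\<close> and on \<open>snd ` S\<close> are rendered as total functions, of which
  only the values on these sets matter.\<close>

definition WEP :: "(real \<times> real) set \<Rightarrow> bool" where
  "WEP S \<longleftrightarrow>
     (\<forall>f :: real \<times> real \<Rightarrow> real. \<exists>(\<phi> :: real \<Rightarrow> real) (h :: real \<Rightarrow> real) (\<psi> :: real \<Rightarrow> real).
        \<forall>(x, y) \<in> S. f (x, y) = \<phi> x + h x * (y - x) - \<psi> y)"

end

theory Submission imports Defs begin

text \<open>
  Give the paths of each cycle alternating signs. The signed sum of \<open>f\<close> along the \<open>i\<close>-th cycle
  kills \<open>\<phi>\<close>, \<open>\<psi>\<close> and the term \<open>h x * x\<close>, which leaves a linear form \<open>\<Sum>x. h x * c i x\<close> in the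
  \<open>n\<close> values of \<open>h\<close> on the union of the \<open>X\<close>-sections. Each row of the square matrix \<open>c\<close> sums to
  \<open>0\<close>, because \<open>y\<close> itself is killed by the signed sum; so the rows are linearly dependent, and
  the WEP would make the signed sums of every \<open>f\<close> satisfy one fixed nontrivial linear relation.
  The indicator of a path that only one cycle contains violates it.
\<close>

text \<open>Gaussian elimination: \<open>B\<close> indexes the equations and \<open>I\<close> the
  unknowns. Each induction step removes one equation and, if some coefficient in it is nonzero, one
  unknown with it, so the unknowns stay in the majority.\<close>

lemma homogeneous_system_nontrivial_solution:
  fixes c :: "'i \<Rightarrow> 'x \<Rightarrow> 'k::field"
  assumes "finite B" "finite I" "card B < card I"
  shows "\<exists>l. (\<exists>i\<in>I. l i \<noteq> 0) \<and> (\<forall>x\<in>B. (\<Sum>i\<in>I. l i * c i x) = 0)"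
  using assms
proof (induction B arbitrary: I c rule: finite_induct)
  case empty
  then have "I \<noteq> {}" by auto
  then show ?case by (intro exI[of _ "\<lambda>_. 1"]) auto
next
  case (insert b B)
  show ?case
  proof (cases "\<forall>i\<in>I. c i b = 0")
    case True
    have "card B < card I" using insert by simp
    then obtain l where "\<exists>i\<in>I. l i \<noteq> 0" "\<forall>x\<in>B. (\<Sum>i\<in>I. l i * c i x) = 0"
      using insert.IH insert.prems by blast
    then show ?thesis using True by (intro exI[of _ l]) auto
  next
    case False
    then obtain j where j: "j \<in> I" "c j b \<noteq> 0" by blast
    let ?J = "I - {j}"
    have "card B < card ?J" "finite ?J" using insert j by auto
    then obtain l where l: "\<exists>i\<in>?J. l i \<noteq> 0"
      "\<forall>x\<in>B. (\<Sum>i\<in>?J. l i * (c i x - c i b / c j b * c j x)) = 0"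
      using insert.IH[of ?J "\<lambda>i x. c i x - c i b / c j b * c j x"] by blast
    \<comment> \<open>The value at the pivot \<open>j\<close> is the one that solves equation
      \<open>b\<close>. Substituting it turns every equation into its reduced form, whose
      coefficients all vanish at \<open>x = b\<close>.\<close>
    define l' where "l' = l(j := - (\<Sum>i\<in>?J. l i * (c i b / c j b)))"
    have eq: "(\<Sum>i\<in>I. l' i * c i x) = (\<Sum>i\<in>?J. l i * (c i x - c i b / c j b * c j x))" for x
    proof -
      have "(\<Sum>i\<in>I. l' i * c i x) = l' j * c j x + (\<Sum>i\<in>?J. l' i * c i x)"
        using j insert.prems by (simp add: sum.remove)
      also have "(\<Sum>i\<in>?J. l' i * c i x) = (\<Sum>i\<in>?J. l i * c i x)"
        by (rule sum.cong) (auto simp: l'_def)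
      also have "l' j * c j x = - (\<Sum>i\<in>?J. l i * (c i b / c j b * c j x))"
        by (simp add: l'_def sum_distrib_right mult.assoc)
      finally show ?thesis by (simp add: right_diff_distrib sum_subtractf)
    qed
    have "\<exists>i\<in>I. l' i \<noteq> 0" using l(1) by (auto simp: l'_def)
    moreover have "(\<Sum>i\<in>I. l' i * c i b) = 0" using eq[of b] j by simp
    ultimately show ?thesis using l(2) eq by (intro exI[of _ l']) auto
  qed
qed

text \<open>Signs +1 and -1 alternate along the cycle. Each vertex \<open>a i\<close> and each
  \<open>b i\<close> lies on exactly one path of either sign, so a function of a single coordinate
  cancels.\<close>

lemma classical_cycle_signs:
  assumes "classical_cycle S C"
  obtains w :: "'a \<times> 'b \<Rightarrow> real" where "finite C" "C \<subseteq> S" "\<And>p. p \<in> C \<Longrightarrow> w p \<noteq> 0"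
    "\<And>g. (\<Sum>p\<in>C. w p * g (fst p)) = 0" "\<And>g. (\<Sum>p\<in>C. w p * g (snd p)) = 0"
proof -
  from assms obtain m :: nat and a b where m: "m \<ge> 2" and a: "inj_on a {1..m}"
    and b: "inj_on b {1..m}"
    and C: "C = {(a i, b i) | i. i \<in> {1..m}} \<union> {(a (Suc i), b i) | i. i \<in> {1..<m}} \<union> {(a 1, b m)}"
    and S: "C \<subseteq> S" unfolding classical_cycle_def by blast
  \<comment> \<open>The cyclic successor makes the closing path \<open>(a 1, b m)\<close> an
    ordinary member of the family \<open>?q\<close>.\<close>
  define next_ix where "next_ix i = (if i < m then Suc i else 1)" for i
  let ?J = "{1..m}"
  let ?p = "\<lambda>i. (a i, b i)" and ?q = "\<lambda>i. (a (next_ix i), b i)"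
  have nextJ: "next_ix ` ?J = ?J"
  proof (rule endo_inj_surj)
    show "next_ix ` ?J \<subseteq> ?J" "inj_on next_ix ?J"
      using m by (auto simp: next_ix_def inj_on_def split: if_splits)
  qed simp
  then have bij: "bij_betw next_ix ?J ?J"
    unfolding bij_betw_def using eq_card_imp_inj_on[of ?J next_ix] by simp
  have "?J = insert m {1..<m}" using m by auto
  then have "?q ` ?J = {(a (Suc i), b i) | i. i \<in> {1..<m}} \<union> {(a 1, b m)}"
    by (auto simp: next_ix_def image_def)
  then have C': "C = ?p ` ?J \<union> ?q ` ?J" unfolding C by blast
  have injp: "inj_on ?p ?J" and injq: "inj_on ?q ?J"
    by (rule inj_onI, use b in \<open>simp add: inj_on_eq_iff\<close>)+
  \<comment> \<open>A common path would have the same index in both families, by injectivity of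
    \<open>b\<close>, and then \<open>a i = a (next_ix i)\<close>; this is impossible since
    \<open>m \<ge> 2\<close> gives \<open>next_ix i \<noteq> i\<close>.\<close>
  have disj: "?p ` ?J \<inter> ?q ` ?J = {}"
  proof -
    have "a i \<noteq> a (next_ix i)" if "i \<in> ?J" for i
    proof -
      have "next_ix i \<in> ?J" using nextJ that by blast
      moreover have "i \<noteq> next_ix i" using m by (auto simp: next_ix_def)
      ultimately show ?thesis using a that by (meson inj_onD)
    qed
    moreover have "i = k" if "i \<in> ?J" "k \<in> ?J" "b i = b k" for i k
      using b that by (meson inj_onD)
    ultimately show ?thesis by (smt (verit) disjoint_iff image_iff prod.inject)
  qed
  define w :: "'a \<times> 'b \<Rightarrow> real" where "w p = (if p \<in> ?p ` ?J then 1 else -1)" for p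
  have signed: "(\<Sum>p\<in>C. w p * g p) = (\<Sum>i\<in>?J. g (?p i)) - (\<Sum>i\<in>?J. g (?q i))" for g
  proof -
    have "(\<Sum>p\<in>C. w p * g p) = (\<Sum>p\<in>?p ` ?J. w p * g p) + (\<Sum>p\<in>?q ` ?J. w p * g p)"
      unfolding C' using disj by (intro sum.union_disjoint) auto
    also have "(\<Sum>p\<in>?p ` ?J. w p * g p) = (\<Sum>p\<in>?p ` ?J. g p)"
      by (rule sum.cong) (auto simp: w_def)
    also have "\<dots> = (\<Sum>i\<in>?J. g (?p i))" using injp by (simp add: sum.reindex)
    also have "(\<Sum>p\<in>?q ` ?J. w p * g p) = (\<Sum>p\<in>?q ` ?J. - g p)"
    proof (rule sum.cong)
      fix p assume "p \<in> ?q ` ?J"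
      then have "p \<notin> ?p ` ?J" using disj by blast
      then show "w p * g p = - g p" by (simp add: w_def)
    qed simp
    also have "\<dots> = - (\<Sum>i\<in>?J. g (?q i))" using injq by (simp add: sum.reindex sum_negf)
    finally show ?thesis by simp
  qed
  show ?thesis
  proof (rule that[of w])
    show "finite C" by (simp add: C')
    \<comment> \<open>In the first coordinate the negative sum is the positive one reindexed by
      \<open>next_ix\<close>; in the second the two agree term by term.\<close>
    show "(\<Sum>p\<in>C. w p * g (fst p)) = 0" for g
      using sum.reindex_bij_betw[OF bij, of "\<lambda>i. g (a i)"] by (simp add: signed)
    show "w p \<noteq> 0" for p by (simp add: w_def)
  qed (simp_all add: S signed)
qed

theorem proposition7p7:
  fixes X Y :: "real set" and S :: "(real \<times> real) set"
    and n :: nat and C :: "nat \<Rightarrow> (real \<times> real) set"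
  assumes "countable X" and "countable Y"
    and "X \<subseteq> {0..}" and "Y \<subseteq> {0..}"
    and "S \<subseteq> X \<times> Y"
    and "n \<ge> 2"
    and cycles: "\<And>i. i \<in> {1..n} \<Longrightarrow> classical_cycle S (C i)"
    and "card (\<Union>i\<in>{1..n}. fst ` C i) = n"
    and free: "\<And>i. i \<in> {1..n} \<Longrightarrow> \<exists>p \<in> C i. \<forall>k \<in> {1..n}. k \<noteq> i \<longrightarrow> p \<notin> C k"
  shows "\<not> WEP S"
proof
  assume wep: "WEP S"
  let ?I = "{1..n}"
  let ?A = "\<Union>i\<in>?I. fst ` C i"
  have "\<forall>i\<in>?I. \<exists>w. finite (C i) \<and> C i \<subseteq> S \<and> (\<forall>p\<in>C i. w p \<noteq> 0) \<and>
      (\<forall>g. (\<Sum>p\<in>C i. w p * g (fst p)) = (0::real)) \<and> (\<forall>g. (\<Sum>p\<in>C i. w p * g (snd p)) = 0)"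
    (is "\<forall>i\<in>?I. ?P i")
  proof
    fix i assume "i \<in> ?I"
    obtain w where "finite (C i)" "C i \<subseteq> S"
      "\<And>p. p \<in> C i \<Longrightarrow> w p \<noteq> 0" "\<And>g. (\<Sum>p\<in>C i. w p * g (fst p)) = (0::real)"
      "\<And>g. (\<Sum>p\<in>C i. w p * g (snd p)) = 0"
      by (rule classical_cycle_signs[OF cycles[OF \<open>i \<in> ?I\<close>]]) (rule that)
    then show "?P i" by (intro exI[of _ w]) auto
  qed
  from bchoice[OF this] obtain w where w: "\<And>i. i \<in> ?I \<Longrightarrow> finite (C i)" "\<And>i. i \<in> ?I \<Longrightarrow> C i \<subseteq> S"
    "\<And>i p. i \<in> ?I \<Longrightarrow> p \<in> C i \<Longrightarrow> w i p \<noteq> 0"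
    "\<And>i g. i \<in> ?I \<Longrightarrow> (\<Sum>p\<in>C i. w i p * g (fst p)) = (0::real)"
    "\<And>i g. i \<in> ?I \<Longrightarrow> (\<Sum>p\<in>C i. w i p * g (snd p)) = 0"
    by blast
  have finA: "finite ?A" using w(1) by blast
  \<comment> \<open>The coefficient of \<open>h x\<close> in the signed sum along cycle
    \<open>i\<close>: only the paths with first coordinate \<open>x\<close> contribute.\<close>
  define c where "c i x = (\<Sum>p\<in>{p \<in> C i. fst p = x}. w i p * snd p)" for i x
  have group: "(\<Sum>p\<in>C i. w i p * (h (fst p) * snd p)) = (\<Sum>x\<in>?A. h x * c i x)"
    if "i \<in> ?I" for i h
  proof -
    have "(\<Sum>x\<in>?A. h x * c i x)
        = (\<Sum>x\<in>?A. \<Sum>p\<in>{p \<in> C i. fst p = x}. w i p * (h (fst p) * snd p))"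
      unfolding c_def sum_distrib_left by (intro sum.cong) auto
    also have "\<dots> = (\<Sum>p\<in>C i. w i p * (h (fst p) * snd p))"
      using that w(1) finA by (intro sum.group) auto
    finally show ?thesis by simp
  qed
  have row_sum: "(\<Sum>x\<in>?A. c i x) = 0" if "i \<in> ?I" for i
    using group[OF that, of "\<lambda>_. 1"] w(5)[OF that, of "\<lambda>y. y"] by simp
  have "?A \<noteq> {}" using assms(6,8) by (metis card.empty not_numeral_le_zero)
  then obtain x0 where x0: "x0 \<in> ?A" by blast
  \<comment> \<open>Leaving out column \<open>x0\<close> gives \<open>n - 1\<close> equations for
    the \<open>n\<close> unknowns \<open>l i\<close>.\<close>
  then have "card (?A - {x0}) < card ?I"
    using assms(6,8) finA by (simp add: card_Diff_singleton)
  then obtain l where l: "\<exists>i\<in>?I. l i \<noteq> 0" "\<forall>x\<in>?A - {x0}. (\<Sum>i\<in>?I. l i * c i x) = 0"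
    using homogeneous_system_nontrivial_solution[of "?A - {x0}" ?I c] finA by blast
  \<comment> \<open>The omitted equation follows from the others: as every row sums to 0, so do the
    left-hand sides over all columns.\<close>
  have dep: "(\<Sum>i\<in>?I. l i * c i x) = 0" if "x \<in> ?A" for x
  proof -
    have "(\<Sum>x\<in>?A. \<Sum>i\<in>?I. l i * c i x) = (\<Sum>i\<in>?I. l i * (\<Sum>x\<in>?A. c i x))"
      by (subst sum.swap) (simp add: sum_distrib_left)
    also have "\<dots> = 0" using row_sum by (intro sum.neutral) auto
    finally have "(\<Sum>x\<in>?A. \<Sum>i\<in>?I. l i * c i x) = 0" .
    moreover have "(\<Sum>x\<in>?A. \<Sum>i\<in>?I. l i * c i x)
        = (\<Sum>i\<in>?I. l i * c i x0) + (\<Sum>x\<in>?A - {x0}. \<Sum>i\<in>?I. l i * c i x)"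
      by (rule sum.remove[OF finA x0])
    moreover have "(\<Sum>x\<in>?A - {x0}. \<Sum>i\<in>?I. l i * c i x) = 0"
      using l(2) by (intro sum.neutral) auto
    ultimately have "(\<Sum>i\<in>?I. l i * c i x0) = 0" by linarith
    then show ?thesis using l(2) that by (cases "x = x0") auto
  qed
  obtain j where j: "j \<in> ?I" "l j \<noteq> 0" using l(1) by blast
  obtain p where p: "p \<in> C j" "\<forall>k\<in>?I. k \<noteq> j \<longrightarrow> p \<notin> C k" using free[OF j(1)] by blast
  \<comment> \<open>The path \<open>p\<close> is private to a cycle \<open>j\<close> whose
    coefficient \<open>l j\<close> in the relation is nonzero.\<close>
  define f :: "real \<times> real \<Rightarrow> real" where "f q = of_bool (q = p)" for q
  obtain \<phi> h \<psi> where rep: "\<forall>(x, y)\<in>S. f (x, y) = \<phi> x + h x * (y - x) - \<psi> y"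
    using wep unfolding WEP_def by blast
  have f_sum: "(\<Sum>q\<in>C i. w i q * f q) = (\<Sum>x\<in>?A. h x * c i x)" if i: "i \<in> ?I" for i
  proof -
    \<comment> \<open>Regrouped into a function of x, the mixed term \<open>h x * y\<close> and a
      function of y; only the mixed term survives the signed sum.\<close>
    have "(\<Sum>q\<in>C i. w i q * f q)
        = (\<Sum>q\<in>C i. w i q * (\<phi> (fst q) - h (fst q) * fst q)
            + w i q * (h (fst q) * snd q) - w i q * \<psi> (snd q))"
    proof (rule sum.cong)
      fix q assume "q \<in> C i"
      then have "q \<in> S" using w(2)[OF i] by blast
      then have fq: "f q = \<phi> (fst q) + h (fst q) * (snd q - fst q) - \<psi> (snd q)"
        using rep by (cases q) auto
      show "w i q * f q = w i q * (\<phi> (fst q) - h (fst q) * fst q)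
            + w i q * (h (fst q) * snd q) - w i q * \<psi> (snd q)"
        unfolding fq by (simp add: algebra_simps)
    qed simp
    also have "\<dots> = (\<Sum>q\<in>C i. w i q * (h (fst q) * snd q))"
      using w(4)[OF i, of "\<lambda>x. \<phi> x - h x * x"] w(5)[OF i, of \<psi>]
      by (simp only: sum.distrib sum_subtractf)
    finally show ?thesis using group[OF i] by simp
  qed
  have "(\<Sum>i\<in>?I. l i * (\<Sum>q\<in>C i. w i q * f q)) = (\<Sum>i\<in>?I. \<Sum>x\<in>?A. h x * (l i * c i x))"
    by (intro sum.cong) (simp_all add: f_sum sum_distrib_left mult.left_commute)
  also have "\<dots> = (\<Sum>x\<in>?A. h x * (\<Sum>i\<in>?I. l i * c i x))"
    by (subst sum.swap) (simp add: sum_distrib_left)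
  also have "\<dots> = 0" using dep by (intro sum.neutral) auto
  finally have zero: "(\<Sum>i\<in>?I. l i * (\<Sum>q\<in>C i. w i q * f q)) = 0" .
  \<comment> \<open>The relation collapses to \<open>l j * w j p = 0\<close>, although both factors
    are nonzero.\<close>
  have "(\<Sum>q\<in>C i. w i q * f q) = (if i = j then w j p else 0)" if "i \<in> ?I" for i
  proof -
    have "(\<Sum>q\<in>C i. w i q * f q) = (\<Sum>q\<in>C i. if q = p then w i q else 0)"
      by (intro sum.cong) (auto simp: f_def)
    then show ?thesis using p that w(1)[OF that] by auto
  qed
  then have "(\<Sum>i\<in>?I. l i * (\<Sum>q\<in>C i. w i q * f q)) = (\<Sum>i\<in>?I. if i = j then l j * w j p else 0)"
    by (intro sum.cong) auto
  also have "\<dots> = l j * w j p" using j(1) by simp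
  finally show False using zero j w(3)[OF j(1) p(1)] by simp
qed

end
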